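(* Let $Q$ be a probability measure on $\Psi$ that is absolutely continuous with respect to $\nu_\Psi$. The Gâteaux derivative of $RB_\Psi(\cdot\,|\,x)$ at $\psi$ in the direction $Q$ (perturbing the marginal prior of $\psi$), i.e. $\lim_{\epsilon\to0}\{RB_{\epsilon,\Psi}(\psi\,|\,x)-RB_\Psi(\psi\,|\,x)\}/\epsilon$, equals $$RB_\Psi(\psi\,|\,x)\left\{1-\frac{m_Q(x)}{m(x)}\right\}.$$
   Context: Setting. $\{f_\theta:\theta\in\Theta\}$ is a statistical model of probability densities with respect to volume measure $\mu$ on a sample space $\mathcal X$ (volume measure on a discrete set is counting measure); $x$ is the observed data. $\Pi$ is a proper prior on $\Theta$ with density $\pi$ with respect to volume measure $\nu$. $\Psi:\Theta\to\Psi$ is an onto map (same symbol for map and range), $\psi=\Psi(\theta)$, $\Pi_\Psi$ is the marginal prior of $\psi$ with density $\pi_\Psi$ with respect to a support measure $\nu_\Psi$ on $\Psi$, and $\Pi(\cdot\,|\,\psi)$ is the conditional prior of $\theta$ given $\Psi(\theta)=\psi$, concentrated on $\Psi^{-1}\{\psi\}$. The conditional prior predictive density is $m(x\,|\,\psi)=\int_{\Psi^{-1}\{\psi\}}f_\theta(x)\,\Pi(d\theta\,|\,\psi)$ and the prior predictive density is $m(x)=\int_\Psi m(x\,|\,\psi)\,\Pi_\Psi(d\psi)$, with $m(x)>0$. The relative belief ratio is $RB_\Psi(\psi\,|\,x)=\pi_\Psi(\psi\,|\,x)/\pi_\Psi(\psi)=m(x\,|\,\psi)/m(x)$, where $\pi_\Psi(\cdot\,|\,x)$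 is the posterior density of $\psi$. Perturbed prior: $\Pi_\epsilon$ is the prior on $\theta$ with marginal $(1-\epsilon)\Pi_\Psi+\epsilon Q$ for $\psi$ and unchanged conditional priors $\Pi(\cdot\,|\,\psi)$ of $\theta$ given $\psi$. Put $m_Q(x)=\int_\Psi m(x\,|\,\psi)\,Q(d\psi)$. The relative belief ratio based on $\Pi_\epsilon$ is $RB_{\epsilon,\Psi}(\psi\,|\,x)=m(x\,|\,\psi)/\{(1-\epsilon)m(x)+\epsilon m_Q(x)\}$. *)

theory Defs
  imports "HOL-Probability.Probability"
begin

text \<open>
  A Bayesian model with a parameter of interest \<open>\<psi> = Psi \<theta>\<close>:
  \<^item> \<open>mu\<close>, \<open>nu\<close>, \<open>nuPsi\<close> are the support measures on the sample space, the parameter space and the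
    range of \<open>Psi\<close>; the volume measures are only one possible choice.
  \<^item> \<open>Pri\<close> is the prior with density \<open>pi0\<close>, and \<open>PriPsi\<close> its marginal with density \<open>piPsi\<close>.
  \<^item> \<open>K \<psi>\<close> is the conditional prior given \<open>Psi \<theta> = \<psi>\<close>. The kernel is fixed as part of the model,
    because it is otherwise determined only \<open>PriPsi\<close>-almost everywhere, whereas a perturbing
    measure need not be absolutely continuous with respect to \<open>PriPsi\<close>.
\<close>

locale bayes_model =
  fixes mu :: "'x measure" and nu :: "'t measure" and f :: "'t \<Rightarrow> 'x \<Rightarrow> real"
    and Pri :: "'t measure" and pi0 :: "'t \<Rightarrow> real"
    and Psi :: "'t \<Rightarrow> 'p" and nuPsi :: "'p measure"
    and PriPsi :: "'p measure" and piPsi :: "'p \<Rightarrow> real"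
    and K :: "'p \<Rightarrow> 't measure"
  assumes f_measurable: "(\<lambda>(\<theta>, x). f \<theta> x) \<in> borel_measurable (nu \<Otimes>\<^sub>M mu)"
    and f_nonneg: "\<And>\<theta> x. \<theta> \<in> space nu \<Longrightarrow> x \<in> space mu \<Longrightarrow> 0 \<le> f \<theta> x"
    and f_density: "\<And>\<theta>. \<theta> \<in> space nu \<Longrightarrow> (\<integral>\<^sup>+ x. ennreal (f \<theta> x) \<partial>mu) = 1"
    and pi0_measurable: "pi0 \<in> borel_measurable nu"
    and pi0_nonneg: "\<And>\<theta>. \<theta> \<in> space nu \<Longrightarrow> 0 \<le> pi0 \<theta>"
    and Pri_density: "Pri = density nu (\<lambda>\<theta>. ennreal (pi0 \<theta>))"
    and Pri_proper: "prob_space Pri"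
    and Psi_measurable: "Psi \<in> nu \<rightarrow>\<^sub>M nuPsi"
    and Psi_onto: "Psi ` space nu = space nuPsi"
    and PriPsi_marginal: "PriPsi = distr Pri nuPsi Psi"
    and piPsi_measurable: "piPsi \<in> borel_measurable nuPsi"
    and piPsi_nonneg: "\<And>\<psi>. \<psi> \<in> space nuPsi \<Longrightarrow> 0 \<le> piPsi \<psi>"
    and PriPsi_density: "PriPsi = density nuPsi (\<lambda>\<psi>. ennreal (piPsi \<psi>))"
    and K_kernel: "K \<in> nuPsi \<rightarrow>\<^sub>M prob_algebra nu"
    and K_concentrated: "\<And>\<psi>. \<psi> \<in> space nuPsi \<Longrightarrow> (AE \<theta> in K \<psi>. \<theta> \<in> Psi -` {\<psi>})"
    and K_disintegrates: "Pri = PriPsi \<bind> K"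

definition cond_pred ::
  "('t \<Rightarrow> 'x \<Rightarrow> real) \<Rightarrow> ('t \<Rightarrow> 'p) \<Rightarrow> ('p \<Rightarrow> 't measure) \<Rightarrow> 'x \<Rightarrow> 'p \<Rightarrow> ennreal" where
  "cond_pred f Psi K x \<psi> = (\<integral>\<^sup>+ \<theta>\<in>Psi -` {\<psi>}. ennreal (f \<theta> x) \<partial>K \<psi>)"

text \<open>The predictive density at \<open>x\<close> when \<open>\<psi>\<close> has the marginal prior \<open>P\<close>: it is \<open>m(x)\<close> for
  \<open>P = PriPsi\<close> and \<open>m\<^sub>Q(x)\<close> for \<open>P = Q\<close>.\<close>

definition pred ::
  "('t \<Rightarrow> 'x \<Rightarrow> real) \<Rightarrow> ('t \<Rightarrow> 'p) \<Rightarrow> ('p \<Rightarrow> 't measure) \<Rightarrow> 'p measure \<Rightarrow> 'x \<Rightarrow> ennreal" where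
  "pred f Psi K P x = (\<integral>\<^sup>+ \<psi>. cond_pred f Psi K x \<psi> \<partial>P)"

text \<open>The quotient \<open>m(x | \<psi>) / m(x)\<close> is the version of (posterior density) / (prior density) of \<open>\<psi>\<close>
  that is also defined where the prior density vanishes; see \<open>posterior_marginal\<close> below.\<close>

definition RB ::
  "('t \<Rightarrow> 'x \<Rightarrow> real) \<Rightarrow> ('t \<Rightarrow> 'p) \<Rightarrow> ('p \<Rightarrow> 't measure) \<Rightarrow> 'p measure \<Rightarrow> 'x \<Rightarrow> 'p \<Rightarrow> real" where
  "RB f Psi K P x \<psi> = enn2real (cond_pred f Psi K x \<psi>) / enn2real (pred f Psi K P x)"

text \<open>The formula makes sense for every real \<open>\<epsilon>\<close>, which allows two-sided limits at \<open>0\<close>. For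
  \<open>0 \<le> \<epsilon> \<le> 1\<close> it is the relative belief ratio of the contaminated prior; see \<open>RB_perturbed\<close> below.\<close>

definition RB_eps ::
  "('t \<Rightarrow> 'x \<Rightarrow> real) \<Rightarrow> ('t \<Rightarrow> 'p) \<Rightarrow> ('p \<Rightarrow> 't measure) \<Rightarrow> 'p measure \<Rightarrow> 'p measure \<Rightarrow> real
     \<Rightarrow> 'x \<Rightarrow> 'p \<Rightarrow> real" where
  "RB_eps f Psi K P Q \<epsilon> x \<psi> = enn2real (cond_pred f Psi K x \<psi>) /
     ((1 - \<epsilon>) * enn2real (pred f Psi K P x) + \<epsilon> * enn2real (pred f Psi K Q x))"

definition perturbed :: "real \<Rightarrow> 'p measure \<Rightarrow> 'p measure \<Rightarrow> 'p measure" where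
  "perturbed \<epsilon> P Q = measure_of (space P) (sets P)
     (\<lambda>A. ennreal (1 - \<epsilon>) * emeasure P A + ennreal \<epsilon> * emeasure Q A)"

lemma sets_perturbed [simp, measurable_cong]: "sets (perturbed \<epsilon> P Q) = sets P"
  by (simp add: perturbed_def)

lemma space_perturbed [simp]: "space (perturbed \<epsilon> P Q) = space P"
  by (simp add: perturbed_def)

lemma emeasure_perturbed:
  assumes "sets Q = sets P" "A \<in> sets P"
  shows "emeasure (perturbed \<epsilon> P Q) A = ennreal (1 - \<epsilon>) * emeasure P A + ennreal \<epsilon> * emeasure Q A"
proof (rule emeasure_measure_of[OF perturbed_def])
  show "countably_additive (sets (perturbed \<epsilon> P Q))
     (\<lambda>A. ennreal (1 - \<epsilon>) * emeasure P A + ennreal \<epsilon> * emeasure Q A)"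
    using assms by (auto intro!: countably_additiveI
        simp: suminf_add[symmetric] suminf_emeasure)
qed (use assms sets.space_closed in \<open>auto simp: positive_def\<close>)

lemma nn_integral_perturbed:
  assumes Q: "sets Q = sets P" and g: "g \<in> borel_measurable P"
  shows "(\<integral>\<^sup>+ y. g y \<partial>perturbed \<epsilon> P Q)
     = ennreal (1 - \<epsilon>) * (\<integral>\<^sup>+ y. g y \<partial>P) + ennreal \<epsilon> * (\<integral>\<^sup>+ y. g y \<partial>Q)"
  using g
proof (induction rule: borel_measurable_induct)
  case (cong u v)
  have "(\<integral>\<^sup>+ y. u y \<partial>M) = (\<integral>\<^sup>+ y. v y \<partial>M)" if "space M = space P" for M
    by (rule nn_integral_cong) (use cong that in auto)
  with cong show ?case
    using sets_eq_imp_space_eq[OF Q] by simp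
next
  case (set A)
  then show ?case
    using Q by (simp add: emeasure_perturbed)
next
  case (mult u c)
  have "u \<in> borel_measurable Q" "u \<in> borel_measurable (perturbed \<epsilon> P Q)"
    using mult Q by (auto cong: measurable_cong_sets)
  with mult show ?case
    by (simp add: nn_integral_cmult algebra_simps)
next
  case (add u v)
  have "u \<in> borel_measurable Q" "u \<in> borel_measurable (perturbed \<epsilon> P Q)"
    "v \<in> borel_measurable Q" "v \<in> borel_measurable (perturbed \<epsilon> P Q)"
    using add Q by (auto cong: measurable_cong_sets)
  with add show ?case
    by (simp add: nn_integral_add algebra_simps)
next
  case (seq U)
  have meas: "U i \<in> borel_measurable Q" "U i \<in> borel_measurable (perturbed \<epsilon> P Q)" for i
    using seq Q by (auto cong: measurable_cong_sets)
  have inc: "incseq (\<lambda>i. \<integral>\<^sup>+ y. U i y \<partial>M)" for M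
    using \<open>incseq U\<close> by (auto simp: incseq_def le_fun_def intro!: nn_integral_mono)
  have sup: "(SUP i. U i) = (\<lambda>y. SUP i. U i y)"
    by (simp add: fun_eq_iff image_comp)
  have "(\<integral>\<^sup>+ y. (SUP i. U i) y \<partial>perturbed \<epsilon> P Q) = (SUP i. \<integral>\<^sup>+ y. U i y \<partial>perturbed \<epsilon> P Q)"
    unfolding sup by (rule nn_integral_monotone_convergence_SUP) (use seq meas in auto)
  also have "\<dots> = (SUP i. ennreal (1 - \<epsilon>) * (\<integral>\<^sup>+ y. U i y \<partial>P) + ennreal \<epsilon> * (\<integral>\<^sup>+ y. U i y \<partial>Q))"
    using seq by simp
  also have "\<dots> = (SUP i. ennreal (1 - \<epsilon>) * (\<integral>\<^sup>+ y. U i y \<partial>P))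
      + (SUP i. ennreal \<epsilon> * (\<integral>\<^sup>+ y. U i y \<partial>Q))"
    by (rule ennreal_SUP_add)
       (use inc in \<open>auto simp: incseq_def intro!: mult_left_mono\<close>)
  also have "\<dots> = ennreal (1 - \<epsilon>) * (\<integral>\<^sup>+ y. (SUP i. U i) y \<partial>P) + ennreal \<epsilon> * (\<integral>\<^sup>+ y. (SUP i. U i) y \<partial>Q)"
    unfolding sup SUP_mult_left_ennreal[symmetric]
    by (subst (1 2) nn_integral_monotone_convergence_SUP) (use seq meas in auto)
  finally show ?case .
qed

context bayes_model
begin

lemma K_subprob: "K \<in> nuPsi \<rightarrow>\<^sub>M subprob_algebra nu"
  by (rule measurable_prob_algebraD[OF K_kernel])

lemma K_prob:
  assumes "\<psi> \<in> space nuPsi"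
  shows "prob_space (K \<psi>)" "sets (K \<psi>) = sets nu"
  using measurable_space[OF K_kernel assms] by (auto simp: space_prob_algebra)

lemma f_section [measurable]:
  assumes "x \<in> space mu"
  shows "(\<lambda>\<theta>. f \<theta> x) \<in> borel_measurable nu"
  using measurable_compose[OF measurable_Pair2'[OF assms] f_measurable] by simp

lemma set_nn_integral_K:
  assumes "\<psi> \<in> space nuPsi"
  shows "(\<integral>\<^sup>+ \<theta>\<in>Psi -` {\<psi>}. g \<theta> \<partial>K \<psi>) = (\<integral>\<^sup>+ \<theta>. g \<theta> \<partial>K \<psi>)"
  by (rule nn_integral_cong_AE) (use K_concentrated[OF assms] in \<open>auto simp: indicator_def\<close>)

lemma cond_pred_eq:
  assumes "\<psi> \<in> space nuPsi"
  shows "cond_pred f Psi K x \<psi> = (\<integral>\<^sup>+ \<theta>. ennreal (f \<theta> x) \<partial>K \<psi>)"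
  unfolding cond_pred_def by (rule set_nn_integral_K[OF assms])

lemma cond_pred_measurable:
  assumes "x \<in> space mu"
  shows "cond_pred f Psi K x \<in> borel_measurable nuPsi"
proof -
  have "(\<lambda>\<psi>. \<integral>\<^sup>+ \<theta>. ennreal (f \<theta> x) \<partial>K \<psi>) \<in> borel_measurable nuPsi"
    using assms
    by (intro measurable_compose[OF K_subprob nn_integral_measurable_subprob_algebra]) measurable
  then show ?thesis
    by (simp add: cond_pred_eq cong: measurable_cong)
qed

lemma bind_K:
  assumes "prob_space P" "sets P = sets nuPsi"
  shows "sets (P \<bind> K) = sets nu"
    and "g \<in> borel_measurable nu \<Longrightarrow> (\<integral>\<^sup>+ \<theta>. g \<theta> \<partial>(P \<bind> K)) = (\<integral>\<^sup>+ \<psi>. \<integral>\<^sup>+ \<theta>. g \<theta> \<partial>K \<psi> \<partial>P)"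
proof -
  have K: "K \<in> P \<rightarrow>\<^sub>M subprob_algebra nu"
    using K_subprob assms by (simp cong: measurable_cong_sets)
  show "sets (P \<bind> K) = sets nu"
    using sets_bind_measurable[OF K] prob_space.not_empty[OF assms(1)] by simp
  show "(\<integral>\<^sup>+ \<theta>. g \<theta> \<partial>(P \<bind> K)) = (\<integral>\<^sup>+ \<psi>. \<integral>\<^sup>+ \<theta>. g \<theta> \<partial>K \<psi> \<partial>P)" if "g \<in> borel_measurable nu"
    by (rule nn_integral_bind[OF that K])
qed

text \<open>The prior \<open>P \<bind> K\<close> has marginal \<open>P\<close> and prior predictive density \<open>pred f Psi K P\<close>, and under
  its posterior given \<open>x\<close> the marginal of \<open>\<psi>\<close> has density \<open>m(x | \<psi>) / m(x)\<close> with respect to \<open>P\<close>.\<close>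

lemma marginal_bind:
  assumes "prob_space P" "sets P = sets nuPsi"
  shows "distr (P \<bind> K) nuPsi Psi = P"
proof (rule measure_eqI)
  fix A assume "A \<in> sets (distr (P \<bind> K) nuPsi Psi)"
  then have A: "A \<in> sets nuPsi" by simp
  have Psi: "Psi \<in> (P \<bind> K) \<rightarrow>\<^sub>M nuPsi"
    using Psi_measurable bind_K(1)[OF assms] by (simp cong: measurable_cong_sets)
  have ind: "(\<lambda>\<theta>. indicator A (Psi \<theta>) :: ennreal) \<in> borel_measurable nu"
    using Psi_measurable A by measurable
  have in_K: "(\<integral>\<^sup>+ \<theta>. indicator A (Psi \<theta>) \<partial>K \<psi>) = indicator A \<psi>" if "\<psi> \<in> space P" for \<psi>
  proof -
    have \<psi>: "\<psi> \<in> space nuPsi" using that sets_eq_imp_space_eq[OF assms(2)] by simp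
    have "(\<integral>\<^sup>+ \<theta>. indicator A (Psi \<theta>) \<partial>K \<psi>) = (\<integral>\<^sup>+ \<theta>. indicator A \<psi> \<partial>K \<psi>)"
      by (rule nn_integral_cong_AE) (use K_concentrated[OF \<psi>] in auto)
    then show ?thesis
      using prob_space.emeasure_space_1[OF K_prob(1)[OF \<psi>]] by simp
  qed
  have "emeasure (distr (P \<bind> K) nuPsi Psi) A = (\<integral>\<^sup>+ \<psi>. indicator A \<psi> \<partial>distr (P \<bind> K) nuPsi Psi)"
    using A by simp
  also have "\<dots> = (\<integral>\<^sup>+ \<theta>. indicator A (Psi \<theta>) \<partial>(P \<bind> K))"
    by (rule nn_integral_distr[OF Psi]) (use A in simp)
  also have "\<dots> = (\<integral>\<^sup>+ \<psi>. indicator A \<psi> \<partial>P)"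
    by (simp add: bind_K(2)[OF assms ind] in_K cong: nn_integral_cong)
  finally show "emeasure (distr (P \<bind> K) nuPsi Psi) A = emeasure P A"
    using A assms by simp
qed (simp add: assms)

lemma predictive_bind:
  assumes "prob_space P" "sets P = sets nuPsi" "x \<in> space mu"
  shows "(\<integral>\<^sup>+ \<theta>. ennreal (f \<theta> x) \<partial>(P \<bind> K)) = pred f Psi K P x"
  unfolding pred_def using assms sets_eq_imp_space_eq[OF assms(2)]
  by (subst bind_K(2)) (auto simp: cond_pred_eq intro!: nn_integral_cong)

lemma posterior_marginal:
  assumes "prob_space P" "sets P = sets nuPsi" "x \<in> space mu"
  shows "distr (density (P \<bind> K) (\<lambda>\<theta>. ennreal (f \<theta> x) / pred f Psi K P x)) nuPsi Psi
     = density P (\<lambda>\<psi>. cond_pred f Psi K x \<psi> / pred f Psi K P x)"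
    (is "distr (density _ ?g) _ _ = density P ?h")
proof (rule measure_eqI)
  fix A assume "A \<in> sets (distr (density (P \<bind> K) ?g) nuPsi Psi)"
  then have A: "A \<in> sets nuPsi" by simp
  note sp = sets_eq_imp_space_eq[OF assms(2)]
  have g: "?g \<in> borel_measurable nu"
    using assms by measurable
  have gb: "?g \<in> borel_measurable (P \<bind> K)"
    using g bind_K(1)[OF assms(1,2)] by (simp cong: measurable_cong_sets)
  have Psi: "Psi \<in> density (P \<bind> K) ?g \<rightarrow>\<^sub>M nuPsi"
    using Psi_measurable bind_K(1)[OF assms(1,2)] by (simp cong: measurable_cong_sets)
  have ind: "(\<lambda>\<theta>. indicator A (Psi \<theta>) :: ennreal) \<in> borel_measurable nu"
    using Psi_measurable A by measurable
  have indb: "(\<lambda>\<theta>. indicator A (Psi \<theta>) :: ennreal) \<in> borel_measurable (P \<bind> K)"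
    using ind bind_K(1)[OF assms(1,2)] by (simp cong: measurable_cong_sets)
  have h: "?h \<in> borel_measurable P"
    using cond_pred_measurable[OF assms(3)] assms(2) by (simp cong: measurable_cong_sets)
  have in_K: "(\<integral>\<^sup>+ \<theta>. ?g \<theta> * indicator A (Psi \<theta>) \<partial>K \<psi>) = ?h \<psi> * indicator A \<psi>"
    if "\<psi> \<in> space P" for \<psi>
  proof -
    have \<psi>: "\<psi> \<in> space nuPsi" using that sp by simp
    have fK: "(\<lambda>\<theta>. ennreal (f \<theta> x)) \<in> borel_measurable (K \<psi>)"
      using f_section[OF assms(3)] K_prob(2)[OF \<psi>] by (simp cong: measurable_cong_sets)
    have "(\<integral>\<^sup>+ \<theta>. ?g \<theta> * indicator A (Psi \<theta>) \<partial>K \<psi>) = (\<integral>\<^sup>+ \<theta>. ?g \<theta> * indicator A \<psi> \<partial>K \<psi>)"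
      by (rule nn_integral_cong_AE) (use K_concentrated[OF \<psi>] in auto)
    also have "\<dots> = ?h \<psi> * indicator A \<psi>"
      using fK by (simp add: nn_integral_multc nn_integral_divide cond_pred_eq[OF \<psi>])
    finally show ?thesis .
  qed
  have "emeasure (distr (density (P \<bind> K) ?g) nuPsi Psi) A
      = (\<integral>\<^sup>+ \<psi>. indicator A \<psi> \<partial>distr (density (P \<bind> K) ?g) nuPsi Psi)"
    using A by simp
  also have "\<dots> = (\<integral>\<^sup>+ \<theta>. indicator A (Psi \<theta>) \<partial>density (P \<bind> K) ?g)"
    by (rule nn_integral_distr[OF Psi]) (use A in simp)
  also have "\<dots> = (\<integral>\<^sup>+ \<theta>. ?g \<theta> * indicator A (Psi \<theta>) \<partial>(P \<bind> K))"
    by (rule nn_integral_density[OF gb indb])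
  also have "\<dots> = (\<integral>\<^sup>+ \<psi>. ?h \<psi> * indicator A \<psi> \<partial>P)"
    by (subst bind_K(2)[OF assms(1,2) borel_measurable_times_ennreal[OF g ind]])
       (auto simp: in_K intro!: nn_integral_cong)
  also have "\<dots> = emeasure (density P ?h) A"
    using h A assms(2) by (simp add: emeasure_density)
  finally show "emeasure (distr (density (P \<bind> K) ?g) nuPsi Psi) A = emeasure (density P ?h) A" .
qed (simp add: assms)

lemma RB_perturbed:
  assumes "x \<in> space mu" "sets Q = sets nuPsi" "0 \<le> \<epsilon>" "\<epsilon> \<le> 1"
    and "pred f Psi K PriPsi x < \<infinity>" "pred f Psi K Q x < \<infinity>"
  shows "RB f Psi K (perturbed \<epsilon> PriPsi Q) x \<psi> = RB_eps f Psi K PriPsi Q \<epsilon> x \<psi>"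
proof -
  have sets: "sets PriPsi = sets nuPsi"
    by (simp add: PriPsi_marginal)
  have "cond_pred f Psi K x \<in> borel_measurable PriPsi"
    using cond_pred_measurable[OF assms(1)] sets by (simp cong: measurable_cong_sets)
  then have "pred f Psi K (perturbed \<epsilon> PriPsi Q) x
      = ennreal (1 - \<epsilon>) * pred f Psi K PriPsi x + ennreal \<epsilon> * pred f Psi K Q x"
    using assms sets by (simp add: pred_def nn_integral_perturbed)
  then show ?thesis
    using assms
    by (simp add: RB_def RB_eps_def enn2real_plus enn2real_mult ennreal_mult_less_top)
qed

end

end

theory Submission
  imports Defs
begin

text \<open>
  With the conditional priors held fixed, contaminating the marginal prior leaves the numerator
  \<open>m(x | \<psi>)\<close> of the relative belief ratio unchanged and moves the denominator along the line
  from \<open>m(x)\<close> to \<open>m\<^sub>Q(x)\<close>. The Gateaux derivative is therefore the ordinary derivative at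
  \<open>0\<close> of a constant divided by an affine function of \<open>\<epsilon>\<close>, which does not vanish near \<open>0\<close> because
  \<open>m(x) > 0\<close>. Its slope is \<open>m\<^sub>Q(x) - m(x)\<close>, and by the quotient rule the derivative is
  \<open>m(x | \<psi>) (m(x) - m\<^sub>Q(x)) / m(x)\<^sup>2\<close>, which is \<open>m(x | \<psi>) / m(x)\<close> times \<open>1 - m\<^sub>Q(x) / m(x)\<close>.
\<close>

lemma DERIV_const_over_mixture_at_0:
  fixes c m q :: real
  assumes "m \<noteq> 0"
  shows "((\<lambda>\<epsilon>. c / ((1 - \<epsilon>) * m + \<epsilon> * q)) has_real_derivative c / m * (1 - q / m)) (at 0)"
  by (rule derivative_eq_intros refl | use assms in \<open>simp add: field_simps power2_eq_square\<close>)+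

theorem proposition3:
  fixes mu :: "'x measure" and nu :: "'t measure" and f :: "'t \<Rightarrow> 'x \<Rightarrow> real"
    and Pri :: "'t measure" and pi0 :: "'t \<Rightarrow> real"
    and Psi :: "'t \<Rightarrow> 'p" and nuPsi :: "'p measure"
    and PriPsi :: "'p measure" and piPsi :: "'p \<Rightarrow> real"
    and K :: "'p \<Rightarrow> 't measure"
    and Q :: "'p measure" and x :: 'x and \<psi> :: 'p
  assumes model: "bayes_model mu nu f Pri pi0 Psi nuPsi PriPsi piPsi K"
    and x: "x \<in> space mu"
    and m_pos: "0 < pred f Psi K PriPsi x"
    and m_finite: "pred f Psi K PriPsi x < \<infinity>"
    and psi: "\<psi> \<in> space nuPsi"
    and m_psi_finite: "cond_pred f Psi K x \<psi> < \<infinity>"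
    and Q_prob: "prob_space Q"
    and Q_sets: "sets Q = sets nuPsi"
    and Q_ac: "absolutely_continuous nuPsi Q"
    and mQ_finite: "pred f Psi K Q x < \<infinity>"
  shows "((\<lambda>\<epsilon>. (RB_eps f Psi K PriPsi Q \<epsilon> x \<psi> - RB f Psi K PriPsi x \<psi>) / \<epsilon>) \<longlongrightarrow>
      RB f Psi K PriPsi x \<psi> *
        (1 - enn2real (pred f Psi K Q x) / enn2real (pred f Psi K PriPsi x))) (at 0)"
proof -
  define c where "c = enn2real (cond_pred f Psi K x \<psi>)"
  define m where "m = enn2real (pred f Psi K PriPsi x)"
  define q where "q = enn2real (pred f Psi K Q x)"
  \<comment> \<open>Finiteness of \<open>m(x)\<close> matters here, because \<open>enn2real\<close> sends \<open>\<infinity>\<close> to \<open>0\<close>.\<close>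
  have "m \<noteq> 0"
    using m_pos m_finite by (auto simp: m_def enn2real_eq_0_iff)
  from DERIV_const_over_mixture_at_0[OF this, of c q]
  show ?thesis
    by (simp add: has_field_derivative_iff RB_eps_def RB_def c_def m_def q_def)
qed

end
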